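(* Let $X$, $Y$ be real normed spaces, $G\subset X$ open, $f,g_1,\dots,g_k,h_1,\dots,h_\ell:G\times Y\to\mathbb{R}$ functions, and for $\pi\in Y$ consider the problem $$(\mathcal M,\pi):\quad\text{maximize } f(x,\pi)\ \text{ subject to } x\in G,\ g_i(x,\pi)\ge0\ (1\le i\le k),\ h_j(x,\pi)=0\ (1\le j\le\ell).$$ Let $\pi_0\in Y$. Assume: (Dua) there is an inner product on the dual $X^*$ which is continuous as a function $X^*\times X^*\to\mathbb{R}$ for the usual dual norm topology; (Sol1) there is an open neighborhood $P$ of $\pi_0$ in $Y$ such that for every $\pi\in P$ there is a solution $\underline{x}(\pi)$ of $(\mathcal M,\pi)$ (this fixes a map $\pi\mapsto\underline{x}(\pi)$ on $P$); (Sol2) there is $\varpi\in Y$ such that $D^+_G\underline{x}(\pi_0;\varpi)$ exists; (Fon1) for every $\psi\in\{f,g_1,\dots,g_k,h_1,\dots,h_\ell\}$, $D_H\psi(\underline{x}(\pi_0),\pi_0)$ exists, and for all $\pi\in P$, $D_{H,1}\psi(\underline{x}(\pi),\pi)$ exists and $\pi\mapsto D_{H,1}\psi(\underline{x}(\pi),\pi)$ is continuous on $P$; (Con1) for all $\pi\in P$ and all $j$, $x\mapsto h_j(x,\pi)$ is continuous on a neighborhood of $\underline{x}(\pi)$; (Con2) $D_{H,1}g_1(\underline{x}(\pi_0),\pi_0),\dots,D_{H,1}g_k(\underline{x}(\pi_0),\pi_0),D_{H,1}h_1(\underline{x}(\pi_0),\pi_0),\dots,D_{H,1}h_\ell(\underline{x}(\pi_0),\pi_0)$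 are linearly independent. Let $Q\subset P$ be an open neighborhood of $\pi_0$ such that for all $\pi\in Q$ the functionals $D_{H,1}g_1(\underline{x}(\pi),\pi),\dots,D_{H,1}g_k(\underline{x}(\pi),\pi),D_{H,1}h_1(\underline{x}(\pi),\pi),\dots,D_{H,1}h_\ell(\underline{x}(\pi),\pi)$ are linearly independent, and for each $\pi\in Q$ let $\lambda_1(\pi),\dots,\lambda_k(\pi)$, $\mu_1(\pi),\dots,\mu_\ell(\pi)$ be real numbers such that $\lambda_i(\pi)\ge0$ and $\lambda_i(\pi)g_i(\underline{x}(\pi),\pi)=0$ for all $i$, and $$D_{H,1}f(\underline{x}(\pi),\pi)+\sum_{i=1}^k\lambda_i(\pi)D_{H,1}g_i(\underline{x}(\pi),\pi)+\sum_{j=1}^\ell\mu_j(\pi)D_{H,1}h_j(\underline{x}(\pi),\pi)=0.$$ Then $\lambda_i\in C^0(Q,\mathbb{R}_+)$ for all $i\in\{1,\dots,k\}$ and $\mu_j\in C^0(Q,\mathbb{R})$ for all $j\in\{1,\dots,\ell\}$.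
   Context: Let $E,F$ be real normed spaces, $U\subset E$ open, $\phi:U\to F$, $x\in U$, $v\in E$. $D^+_G\phi(x;v)=\lim_{\theta\to0+}\frac1\theta(\phi(x+\theta v)-\phi(x))$ when it exists. $\phi$ has Hadamard variation $D^+_H\phi(x;v)$ if for all sequences $\theta_n>0$, $\theta_n\to0$, and $v_n\to v$, $\frac1{\theta_n}(\phi(x+\theta_nv_n)-\phi(x))\to D^+_H\phi(x;v)$; if it exists for all $v$ and is continuous linear in $v$ it is the Hadamard differential $D_H\phi(x)$. $D_{H,1}$ is the partial Hadamard differential with respect to the first variable. Dual spaces carry their usual norms. $C^0(A,B)$ denotes the continuous mappings from $A$ into $B$. *)

theory Defs
  imports "HOL-Analysis.Analysis"
begin

(* A map defined only on an open set U is represented by a total function.  At a point of U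
   the notions below depend only on the values near that point (a sequence x + theta_n v_n
   leaves U for finitely many n at most), so U is not a parameter. *)

definition has_gateaux_variation ::
    "('a::real_normed_vector \<Rightarrow> 'b::real_normed_vector) \<Rightarrow> 'a \<Rightarrow> 'a \<Rightarrow> 'b \<Rightarrow> bool" where
  "has_gateaux_variation \<phi> x v d \<longleftrightarrow>
     ((\<lambda>\<theta>. (1 / \<theta>) *\<^sub>R (\<phi> (x + \<theta> *\<^sub>R v) - \<phi> x)) \<longlongrightarrow> d) (at_right (0::real))"

definition has_hadamard_variation ::
    "('a::real_normed_vector \<Rightarrow> 'b::real_normed_vector) \<Rightarrow> 'a \<Rightarrow> 'a \<Rightarrow> 'b \<Rightarrow> bool" where
  "has_hadamard_variation \<phi> x v d \<longleftrightarrow>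
     (\<forall>\<theta> w. (\<forall>n. \<theta> n > (0::real)) \<and> \<theta> \<longlonglongrightarrow> 0 \<and> w \<longlonglongrightarrow> v \<longrightarrow>
        (\<lambda>n. (1 / \<theta> n) *\<^sub>R (\<phi> (x + \<theta> n *\<^sub>R w n) - \<phi> x)) \<longlonglongrightarrow> d)"

definition has_hadamard_differential ::
    "('a::real_normed_vector \<Rightarrow> 'b::real_normed_vector) \<Rightarrow> 'a \<Rightarrow> ('a \<Rightarrow>\<^sub>L 'b) \<Rightarrow> bool" where
  "has_hadamard_differential \<phi> x D \<longleftrightarrow> (\<forall>v. has_hadamard_variation \<phi> x v (blinfun_apply D v))"

definition hadamard_differentiable ::
    "('a::real_normed_vector \<Rightarrow> 'b::real_normed_vector) \<Rightarrow> 'a \<Rightarrow> bool" where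
  "hadamard_differentiable \<phi> x \<longleftrightarrow> (\<exists>D. has_hadamard_differential \<phi> x D)"

definition hadamard_differential ::
    "('a::real_normed_vector \<Rightarrow> 'b::real_normed_vector) \<Rightarrow> 'a \<Rightarrow> ('a \<Rightarrow>\<^sub>L 'b)" where
  "hadamard_differential \<phi> x = (THE D. has_hadamard_differential \<phi> x D)"

lemma has_hadamard_variation_unique:
  assumes "has_hadamard_variation \<phi> x v d" and "has_hadamard_variation \<phi> x v e"
  shows "d = e"
proof -
  let ?\<theta> = "\<lambda>n. inverse (real (Suc n))"
  let ?q = "\<lambda>n. (1 / ?\<theta> n) *\<^sub>R (\<phi> (x + ?\<theta> n *\<^sub>R v) - \<phi> x)"
  have c: "(\<forall>n. ?\<theta> n > 0) \<and> ?\<theta> \<longlonglongrightarrow> 0 \<and> (\<lambda>_. v) \<longlonglongrightarrow> v"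
    using LIMSEQ_inverse_real_of_nat by auto
  have "?q \<longlonglongrightarrow> d"
    by (rule assms(1)[unfolded has_hadamard_variation_def, rule_format, OF c])
  moreover have "?q \<longlonglongrightarrow> e"
    by (rule assms(2)[unfolded has_hadamard_variation_def, rule_format, OF c])
  ultimately show ?thesis
    by (rule LIMSEQ_unique)
qed

lemma hadamard_differential_eq:
  assumes "has_hadamard_differential \<phi> x D"
  shows "hadamard_differential \<phi> x = D"
  unfolding hadamard_differential_def
proof (rule the_equality)
  show "has_hadamard_differential \<phi> x D" by fact
next
  fix D' assume "has_hadamard_differential \<phi> x D'"
  with assms show "D' = D"
    unfolding has_hadamard_differential_def
    by (intro blinfun_eqI) (blast intro: has_hadamard_variation_unique)
qed

definition hadamard_differentiable1 ::
    "('a::real_normed_vector \<times> 'c \<Rightarrow> 'b::real_normed_vector) \<Rightarrow> 'a \<times> 'c \<Rightarrow> bool" where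
  "hadamard_differentiable1 \<psi> z \<longleftrightarrow> hadamard_differentiable (\<lambda>x. \<psi> (x, snd z)) (fst z)"

definition hadamard_differential1 ::
    "('a::real_normed_vector \<times> 'c \<Rightarrow> 'b::real_normed_vector) \<Rightarrow> 'a \<times> 'c \<Rightarrow> ('a \<Rightarrow>\<^sub>L 'b)" where
  "hadamard_differential1 \<psi> z = hadamard_differential (\<lambda>x. \<psi> (x, snd z)) (fst z)"

definition is_inner_product :: "('a::real_vector \<Rightarrow> 'a \<Rightarrow> real) \<Rightarrow> bool" where
  "is_inner_product B \<longleftrightarrow>
     bilinear B \<and> (\<forall>p q. B p q = B q p) \<and> (\<forall>p. p \<noteq> 0 \<longrightarrow> B p p > 0)"

(* Independence of a family, as opposed to its set of members: a repeated member makes the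
   family dependent, hence the injectivity. *)

definition independent_family :: "('i \<Rightarrow> 'a::real_vector) \<Rightarrow> 'i set \<Rightarrow> bool" where
  "independent_family F I \<longleftrightarrow> inj_on F I \<and> independent (F ` I)"

lemma independent_family_finite_iff:
  assumes "finite I"
  shows "independent_family F I \<longleftrightarrow>
    (\<forall>c. (\<Sum>i\<in>I. c i *\<^sub>R F i) = 0 \<longrightarrow> (\<forall>i\<in>I. c i = 0))"
proof (intro iffI allI impI ballI)
  fix c i
  assume F: "independent_family F I" and s: "(\<Sum>i\<in>I. c i *\<^sub>R F i) = 0" and i: "i \<in> I"
  from F have inj: "inj_on F I" and ind: "independent (F ` I)"
    by (auto simp: independent_family_def)
  have "(\<Sum>v\<in>F ` I. c (inv_into I F v) *\<^sub>R v) = 0"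
    using s inj by (simp add: sum.reindex)
  moreover have "finite (F ` I)" using assms by simp
  ultimately have "\<forall>v\<in>F ` I. c (inv_into I F v) = 0"
    using ind real_vector.dependent_finite by fast
  then show "c i = 0" using i inj by simp
next
  assume c: "\<forall>c. (\<Sum>i\<in>I. c i *\<^sub>R F i) = 0 \<longrightarrow> (\<forall>i\<in>I. c i = 0)"
  have inj: "inj_on F I"
  proof (rule inj_onI, rule ccontr)
    fix i j assume i: "i \<in> I" and j: "j \<in> I" and e: "F i = F j" and n: "i \<noteq> j"
    let ?c = "\<lambda>m. (if m = i then 1 else 0) - (if m = j then 1 else (0::real))"
    have "(\<Sum>m\<in>I. ?c m *\<^sub>R F m) = (\<Sum>m\<in>I. (if m = i then F i else 0) - (if m = j then F j else 0))"
      by (rule sum.cong) auto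
    also have "\<dots> = 0" using assms i j e by (simp add: sum_subtractf)
    finally have "?c i = 0" using i by (rule c[rule_format])
    with n show False by simp
  qed
  have "independent (F ` I)"
  proof
    assume "dependent (F ` I)"
    then obtain u v where u: "v \<in> F ` I" "u v \<noteq> 0" "(\<Sum>v\<in>F ` I. u v *\<^sub>R v) = 0"
      using assms real_vector.dependent_finite[of "F ` I"] by auto
    then have "(\<Sum>i\<in>I. u (F i) *\<^sub>R F i) = 0" using inj by (simp add: sum.reindex)
    then have "\<forall>i\<in>I. u (F i) = 0" using c[rule_format, of "\<lambda>i. u (F i)"] by blast
    with u show False by auto
  qed
  with inj show "independent_family F I" by (simp add: independent_family_def)
qed

definition feasible_set ::
    "'a set \<Rightarrow> nat \<Rightarrow> (nat \<Rightarrow> 'a \<times> 'b \<Rightarrow> real) \<Rightarrow> nat \<Rightarrow> (nat \<Rightarrow> 'a \<times> 'b \<Rightarrow> real) \<Rightarrow> 'b \<Rightarrow> 'a set" where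
  "feasible_set G k g l h \<pi> =
     {x \<in> G. (\<forall>i\<in>{1..k}. g i (x, \<pi>) \<ge> 0) \<and> (\<forall>j\<in>{1..l}. h j (x, \<pi>) = 0)}"

definition is_solution ::
    "'a set \<Rightarrow> ('a \<times> 'b \<Rightarrow> real) \<Rightarrow> nat \<Rightarrow> (nat \<Rightarrow> 'a \<times> 'b \<Rightarrow> real) \<Rightarrow>
     nat \<Rightarrow> (nat \<Rightarrow> 'a \<times> 'b \<Rightarrow> real) \<Rightarrow> 'b \<Rightarrow> 'a \<Rightarrow> bool" where
  "is_solution G f k g l h \<pi> x \<longleftrightarrow>
     x \<in> feasible_set G k g l h \<pi> \<and> (\<forall>y\<in>feasible_set G k g l h \<pi>. f (y, \<pi>) \<le> f (x, \<pi>))"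

definition constraint_differentials_independent ::
    "nat \<Rightarrow> (nat \<Rightarrow> 'a::real_normed_vector \<times> 'b \<Rightarrow> real) \<Rightarrow>
     nat \<Rightarrow> (nat \<Rightarrow> 'a \<times> 'b \<Rightarrow> real) \<Rightarrow> 'a \<times> 'b \<Rightarrow> bool" where
  "constraint_differentials_independent k g l h z \<longleftrightarrow>
     independent_family
       (case_sum (\<lambda>i. hadamard_differential1 (g i) z) (\<lambda>j. hadamard_differential1 (h j) z))
       ({1..k} <+> {1..l})"

end

(* Coordinates with respect to a continuously moving linearly independent family are continuous.
   Induction on the size of the family: projecting along one member F a onto its orthogonal
   complement for the continuous inner product removes the coordinate of F a and keeps the
   others, which are continuous by induction; the remaining one is then read off by pairing
   with F a. The multiplier rule exhibits the multipliers as the coordinates of minus the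
   partial differential of f in the family of the differentials of the constraints. *)

theory Submission
  imports Defs
begin

lemma continuous_on_coefficients:
  fixes F :: "'i \<Rightarrow> 'a::topological_space \<Rightarrow> 'v::real_normed_vector"
    and c :: "'i \<Rightarrow> 'a \<Rightarrow> real"
    and B :: "'v \<Rightarrow> 'v \<Rightarrow> real"
  assumes B: "is_inner_product B" "continuous_on UNIV (\<lambda>(p, q). B p q)"
    and "finite I"
    and "\<And>i. i \<in> I \<Longrightarrow> continuous_on S (F i)"
    and "\<And>x. x \<in> S \<Longrightarrow> independent_family (\<lambda>i. F i x) I"
    and "continuous_on S (\<lambda>x. \<Sum>i\<in>I. c i x *\<^sub>R F i x)"
  shows "\<forall>i\<in>I. continuous_on S (c i)"
  using assms(3-)
\<comment> \<open>Only the family is generalized: the step applies the hypothesis to projected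
  vectors, whose coefficients are the same \<open>c\<close> on the same set
  \<open>S\<close>.\<close>
proof (induction I arbitrary: F rule: finite_induct)
  case empty
  then show ?case by simp
next
  case (insert a I F)
  have bil: "bilinear B" and pos: "\<And>p. p \<noteq> 0 \<Longrightarrow> B p p > 0"
    using B(1) by (auto simp: is_inner_product_def)
  have contB: "continuous_on S (\<lambda>x. B (u x) (v x))"
    if "continuous_on S u" "continuous_on S v" for u v
    using continuous_on_compose2[OF B(2) continuous_on_Pair[OF that]] by simp
  have F: "continuous_on S (F i)" if "i \<in> insert a I" for i
    using insert.prems(1) that .
  have ind: "\<forall>i\<in>insert a I. d i = 0"
    if "x \<in> S" "(\<Sum>i\<in>insert a I. d i *\<^sub>R F i x) = 0" for x d
    using insert.prems(2)[OF that(1)] that(2) insert.hyps(1)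
      independent_family_finite_iff[of "insert a I" "\<lambda>i. F i x"] finite_insert by blast
  have Fa: "B (F a x) (F a x) \<noteq> 0" if "x \<in> S" for x
  proof -
    \<comment> \<open>Otherwise the indicator of \<open>a\<close> would be a nontrivial relation at
      \<open>x\<close>.\<close>
    have "F a x \<noteq> 0"
    proof
      assume "F a x = 0"
      then have "(\<Sum>i\<in>insert a I. (if i = a then 1 else 0) *\<^sub>R F i x) = 0"
        by (intro sum.neutral) auto
      from ind[OF that this] show False by simp
    qed
    from pos[OF this] show ?thesis by simp
  qed
  \<comment> \<open>\<open>r p x\<close> is the coefficient of the \<open>B\<close>-orthogonal
    projection of \<open>p\<close> onto the line of \<open>F a x\<close>; \<open>T p x\<close> is
    the component of \<open>p\<close> orthogonal to that line.\<close>
  define r where "r p x = B p (F a x) / B (F a x) (F a x)" for p x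
  define T where "T p x = p - r p x *\<^sub>R F a x" for p x
  have contr: "continuous_on S (\<lambda>x. r (u x) x)" if "continuous_on S u" for u
    unfolding r_def using Fa by (intro continuous_intros contB that F) auto
  have contT: "continuous_on S (\<lambda>x. T (u x) x)" if "continuous_on S u" for u
    unfolding T_def by (intro continuous_intros contr that F) auto
  \<comment> \<open>This holds off \<open>S\<close> too: if the denominator vanishes there, division
    by zero makes \<open>r\<close> the zero map.\<close>
  have linr: "linear (\<lambda>p. r p x)" for x
    using bil unfolding bilinear_def r_def linear_iff by (simp add: add_divide_distrib)
  have linT: "linear (\<lambda>p. T p x)" for x
    unfolding T_def
    by (simp add: linear_iff linear_add[OF linr] linear_cmul[OF linr] algebra_simps)
  have ra: "r (F a x) x = 1" and Ta: "T (F a x) x = 0" if "x \<in> S" for x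
    using Fa[OF that] by (auto simp: T_def r_def)
  let ?s = "\<lambda>x. \<Sum>i\<in>insert a I. c i x *\<^sub>R F i x"
  have "\<forall>i\<in>I. continuous_on S (c i)"
  proof (rule insert.IH[of "\<lambda>i x. T (F i x) x"])
    show "continuous_on S (\<lambda>x. T (F i x) x)" if "i \<in> I" for i
      using that by (intro contT F) simp
    show "independent_family (\<lambda>i. T (F i x) x) I" if x: "x \<in> S" for x
      unfolding independent_family_finite_iff[OF insert.hyps(1)]
    proof (intro allI impI)
      fix d
      assume d: "(\<Sum>i\<in>I. d i *\<^sub>R T (F i x) x) = 0"
      \<comment> \<open>A relation among the projected vectors lifts to one among the original
        vectors: the new coefficient at \<open>a\<close> collects the multiples of
        \<open>F a x\<close> that \<open>T\<close> subtracts. Since \<open>a\<close> lies outside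
        \<open>I\<close>, \<open>e\<close> agrees with \<open>d\<close> on \<open>I\<close>.\<close>
      define e where "e = d(a := - (\<Sum>i\<in>I. d i * r (F i x) x))"
      have "(\<Sum>i\<in>insert a I. e i *\<^sub>R F i x) = e a *\<^sub>R F a x + (\<Sum>i\<in>I. d i *\<^sub>R F i x)"
        using insert.hyps by (auto simp: e_def intro!: sum.cong)
      also have "\<dots> = (\<Sum>i\<in>I. d i *\<^sub>R T (F i x) x)"
        by (simp add: e_def T_def scaleR_diff_right sum_subtractf scaleR_sum_left)
      finally have "\<forall>i\<in>insert a I. e i = 0"
        using d by (intro ind[OF x]) simp
      with insert.hyps(2) show "\<forall>i\<in>I. d i = 0"
        by (auto simp: e_def split: if_splits)
    qed
    \<comment> \<open>\<open>T\<close> annihilates the term of \<open>a\<close>, so projecting the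
      full sum, which is continuous by assumption, gives the sum over the smaller family.\<close>
    have "(\<Sum>i\<in>I. c i x *\<^sub>R T (F i x) x) = T (?s x) x" if "x \<in> S" for x
      using insert.hyps Ta[OF that]
      by (simp add: linear_add[OF linT] linear_cmul[OF linT] linear_sum[OF linT])
    with contT[OF insert.prems(3)]
    show "continuous_on S (\<lambda>x. \<Sum>i\<in>I. c i x *\<^sub>R T (F i x) x)"
      by (simp cong: continuous_on_cong)
  qed
  moreover have "continuous_on S (c a)"
  proof -
    \<comment> \<open>Removing the terms whose coefficients are already known to be continuous
      leaves \<open>c a x *\<^sub>R F a x\<close>, and \<open>r\<close> takes the value 1 at
      \<open>F a x\<close>.\<close>
    have "r (?s x - (\<Sum>i\<in>I. c i x *\<^sub>R F i x)) x = c a x" if "x \<in> S" for x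
      using insert.hyps ra[OF that] by (simp add: linear_cmul[OF linr])
    moreover have "continuous_on S (\<lambda>x. r (?s x - (\<Sum>i\<in>I. c i x *\<^sub>R F i x)) x)"
      using calculation[symmetric] \<open>\<forall>i\<in>I. continuous_on S (c i)\<close>
      by (intro contr continuous_on_diff insert.prems(3) continuous_on_sum continuous_on_scaleR F) auto
    ultimately show ?thesis
      by (simp cong: continuous_on_cong)
  qed
  ultimately show ?case by simp
qed

theorem lemma4p4:
  fixes G :: "'x::real_normed_vector set"
    and f :: "'x \<times> 'y::real_normed_vector \<Rightarrow> real"
    and k l :: nat
    and g h :: "nat \<Rightarrow> 'x \<times> 'y \<Rightarrow> real"
    and \<pi>0 :: 'y
    and P Q :: "'y set"
    and sol :: "'y \<Rightarrow> 'x"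
    and lam mu :: "nat \<Rightarrow> 'y \<Rightarrow> real"
  assumes G: "open G"
    and Dua: "\<exists>B :: ('x \<Rightarrow>\<^sub>L real) \<Rightarrow> ('x \<Rightarrow>\<^sub>L real) \<Rightarrow> real.
      is_inner_product B \<and> continuous_on UNIV (\<lambda>(p, q). B p q)"
    and Sol1: "open P" "\<pi>0 \<in> P" "\<And>\<pi>. \<pi> \<in> P \<Longrightarrow> is_solution G f k g l h \<pi> (sol \<pi>)"
    and Sol2: "\<exists>v d. has_gateaux_variation sol \<pi>0 v d"
    and Fon1: "\<And>\<psi>. \<psi> \<in> {f} \<union> g ` {1..k} \<union> h ` {1..l} \<Longrightarrow>
      hadamard_differentiable \<psi> (sol \<pi>0, \<pi>0) \<and>
      (\<forall>\<pi>\<in>P. hadamard_differentiable1 \<psi> (sol \<pi>, \<pi>)) \<and>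
      continuous_on P (\<lambda>\<pi>. hadamard_differential1 \<psi> (sol \<pi>, \<pi>))"
    and Con1: "\<And>\<pi> j. \<pi> \<in> P \<Longrightarrow> j \<in> {1..l} \<Longrightarrow>
      \<exists>U. open U \<and> sol \<pi> \<in> U \<and> U \<subseteq> G \<and> continuous_on U (\<lambda>x. h j (x, \<pi>))"
    and Con2: "constraint_differentials_independent k g l h (sol \<pi>0, \<pi>0)"
    and Q: "open Q" "\<pi>0 \<in> Q" "Q \<subseteq> P"
      "\<And>\<pi>. \<pi> \<in> Q \<Longrightarrow> constraint_differentials_independent k g l h (sol \<pi>, \<pi>)"
    and lam: "\<And>\<pi> i. \<pi> \<in> Q \<Longrightarrow> i \<in> {1..k} \<Longrightarrow> lam i \<pi> \<ge> 0 \<and> lam i \<pi> * g i (sol \<pi>, \<pi>) = 0"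
    and multipliers: "\<And>\<pi>. \<pi> \<in> Q \<Longrightarrow>
      hadamard_differential1 f (sol \<pi>, \<pi>)
        + (\<Sum>i=1..k. lam i \<pi> *\<^sub>R hadamard_differential1 (g i) (sol \<pi>, \<pi>))
        + (\<Sum>j=1..l. mu j \<pi> *\<^sub>R hadamard_differential1 (h j) (sol \<pi>, \<pi>)) = 0"
  shows "(\<forall>i\<in>{1..k}. continuous_on Q (lam i) \<and> lam i ` Q \<subseteq> {0..}) \<and>
    (\<forall>j\<in>{1..l}. continuous_on Q (mu j))"
proof -
  obtain B :: "('x \<Rightarrow>\<^sub>L real) \<Rightarrow> ('x \<Rightarrow>\<^sub>L real) \<Rightarrow> real"
    where B: "is_inner_product B" "continuous_on UNIV (\<lambda>(p, q). B p q)"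
    using Dua by blast
  let ?D = "\<lambda>\<psi> \<pi>. hadamard_differential1 \<psi> (sol \<pi>, \<pi>)"
  let ?I = "{1..k} <+> {1..l}"
  \<comment> \<open>Indices in a disjoint sum merge both kinds of constraints into one family, with
    \<open>lam\<close> and \<open>mu\<close> as its coefficients.\<close>
  define F where "F i \<pi> = case_sum (\<lambda>i. ?D (g i) \<pi>) (\<lambda>j. ?D (h j) \<pi>) i" for i \<pi>
  define c where "c = case_sum lam mu"
  have D: "continuous_on Q (?D \<psi>)" if "\<psi> \<in> {f} \<union> g ` {1..k} \<union> h ` {1..l}" for \<psi>
    using Fon1[OF that] Q(3) continuous_on_subset by blast
  have "\<forall>i\<in>?I. continuous_on Q (c i)"
  proof (rule continuous_on_coefficients[OF B])
    show "continuous_on Q (F i)" if "i \<in> ?I" for i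
      using that unfolding F_def by (auto intro!: D)
    show "independent_family (\<lambda>i. F i \<pi>) ?I" if "\<pi> \<in> Q" for \<pi>
      using Q(4)[OF that] by (simp add: constraint_differentials_independent_def F_def)
    \<comment> \<open>The multiplier equation solved for the constraint terms: the combination is
      continuous because the differential of \<open>f\<close> is, with no prior knowledge about the
      multipliers.\<close>
    have "(\<Sum>i\<in>?I. c i \<pi> *\<^sub>R F i \<pi>) = - ?D f \<pi>" if "\<pi> \<in> Q" for \<pi>
      using multipliers[OF that]
      by (simp add: sum.Plus c_def F_def eq_neg_iff_add_eq_0 add_ac)
    moreover have "continuous_on Q (\<lambda>\<pi>. - ?D f \<pi>)"
      by (intro continuous_on_minus D) simp
    ultimately show "continuous_on Q (\<lambda>\<pi>. \<Sum>i\<in>?I. c i \<pi> *\<^sub>R F i \<pi>)"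
      by (simp cong: continuous_on_cong)
  qed simp
  then have "continuous_on Q (c (Inl i))" if "i \<in> {1..k}" for i
    using that by blast
  moreover have "continuous_on Q (c (Inr j))" if "j \<in> {1..l}" for j
    using that \<open>\<forall>i\<in>?I. continuous_on Q (c i)\<close> by blast
  ultimately show ?thesis
    using lam by (auto simp: c_def)
qed

end
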